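(* There exists a tight $11$-point simplex in $G(2,5)$. In fact, there is such a tight simplex with cyclic symmetry, i.e., one mapped to itself by the isometry of $G(2,5)$ induced by the cyclic coordinate shift $\sigma(x_1,\dots,x_5)=(x_2,\dots,x_5,x_1)$ of $\mathbb{R}^5$.
   Context: $G(m,n)$ is the space of $m$-dimensional linear subspaces of $\mathbb{R}^n$, each identified with its orthogonal projection matrix. A tight $N$-point simplex in $G(m,n)$ is a set of $N$ distinct subspaces with projection matrices $\Pi_1,\dots,\Pi_N$ such that $\operatorname{tr}(\Pi_i\Pi_j)=\frac{m(Nm-n)}{n(N-1)}$ for all $i\ne j$. *)

theory Defs
  imports "HOL-Analysis.Analysis"
begin

text \<open>G(m,n): m-dimensional subspaces of R^n, each identified with its orthogonal
projection matrix, i.e. a symmetric idempotent real n x n matrix of rank m.\<close>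
definition grassmannian :: "nat \<Rightarrow> (real^'n^'n) set" where
  "grassmannian m = {P. transpose P = P \<and> P ** P = P \<and> rank P = m}"

definition tight_simplex :: "nat \<Rightarrow> nat \<Rightarrow> (real^'n^'n) set \<Rightarrow> bool" where
  "tight_simplex m N S \<longleftrightarrow>
     S \<subseteq> grassmannian m \<and> finite S \<and> card S = N \<and>
     (\<forall>P\<in>S. \<forall>Q\<in>S. P \<noteq> Q \<longrightarrow>
        trace (P ** Q) = real m * (real N * real m - real CARD('n)) / (real CARD('n) * (real N - 1)))"

text \<open>Matrix of the cyclic coordinate shift sigma(x_1,...,x_5) = (x_2,...,x_5,x_1),
i.e. (sigma x)_i = x_(i+1), indices taken mod 5.\<close>
definition cyc_shift :: "real^5^5" where
  "cyc_shift = (\<chi> i j. if j = i + 1 then 1 else 0)"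

text \<open>The isometry of G(2,5) induced by sigma: the subspace V is sent to sigma(V),
whose projection matrix is sigma P sigma^T.\<close>
definition shift_action :: "real^5^5 \<Rightarrow> real^5^5" where
  "shift_action P = cyc_shift ** P ** transpose cyc_shift"

end

theory Submission
  imports Defs
begin

text \<open>
  The simplex consists of the shift-invariant plane spanned by the vectors \<open>cos (2 \<pi> i / 5)\<close> and
  \<open>sin (2 \<pi> i / 5)\<close>, and of the shift orbits of two further planes \<open>A\<close> and \<open>B\<close>. Orthonormal
  bases of \<open>A\<close> and \<open>B\<close> have 20 coordinates; freezing four of them removes the freedom of rotating
  the bases and of acting by the torus that commutes with the shift. If the sums of the entries of
  the two projections along the cyclic diagonals are prescribed suitably, then the sum of the
  traces against all shifts of a plane is right, and the remaining conditions form a square system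
  of 16 polynomial equations. At an approximate rational solution it is preconditioned with an
  approximate inverse of the Jacobian matrix, and Brouwer's fixed point theorem gives an exact
  solution in a small parallelotope around it. That the map in question preserves the
  parallelotope is verified with affine arithmetic over the integers.
\<close>

section \<open>Zeros of maps close to the identity on a cube\<close>

text \<open>By \<open>near_id\<close> the map sending y to y - F y preserves the cube, so Brouwer's
  theorem gives it a fixed point, and there \<open>F\<close> vanishes.\<close>

lemma zero_in_cube:
  fixes F :: "(nat \<Rightarrow> real) \<Rightarrow> nat \<Rightarrow> real"
  assumes cont: "\<And>i. i < CARD('n::finite) \<Longrightarrow> continuous_on UNIV (\<lambda>y. F y i)"
    and near_id: "\<And>y i. (\<And>k. \<bar>y k\<bar> \<le> 1) \<Longrightarrow> i < CARD('n) \<Longrightarrow> \<bar>y i - F y i\<bar> \<le> 1"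
  shows "\<exists>y. \<forall>i < CARD('n). F y i = 0"
proof -
  obtain b :: "nat \<Rightarrow> 'n" where b: "bij_betw b {0..<CARD('n)} UNIV"
    using ex_bij_betw_nat_finite[of "UNIV :: 'n set"] by auto
  define ix where "ix = inv_into {0..<CARD('n)} b"
  have ix: "ix j < CARD('n)" "b (ix j) = j" for j
    using b bij_betw_imp_surj_on[OF b] inv_into_into[of j b "{0..<CARD('n)}"]
      f_inv_into_f[of j b "{0..<CARD('n)}"] by (auto simp: ix_def)
  have bix: "ix (b i) = i" if "i < CARD('n)" for i
    using b that by (simp add: ix_def bij_betw_def)
  \<comment> \<open>The default 0 beyond the dimension keeps every coordinate in [-1, 1], as
    \<open>near_id\<close> demands for all indices.\<close>
  define e :: "real^'n \<Rightarrow> nat \<Rightarrow> real" where "e v k = (if k < CARD('n) then v $ b k else 0)" for v k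
  define g :: "real^'n \<Rightarrow> real^'n" where "g v = (\<chi> j. e v (ix j) - F (e v) (ix j))" for v
  define Q :: "(real^'n) set" where "Q = cbox (\<chi> j. -1) (\<chi> j. 1)"
  have Q: "v \<in> Q \<longleftrightarrow> (\<forall>j. \<bar>v $ j\<bar> \<le> 1)" for v
    by (auto simp: Q_def mem_box_cart abs_le_iff minus_le_iff)
  have contk: "continuous_on Q (\<lambda>v. e v k)" for k
    by (cases "k < CARD('n)") (auto simp: e_def intro!: continuous_intros)
  have conte: "continuous_on Q e"
    by (rule continuous_on_coordinatewise_then_product) (rule contk)
  have contF: "continuous_on Q (\<lambda>v. F (e v) (ix j))" for j
    by (rule continuous_on_compose2[OF cont[OF ix(1)] conte]) auto
  have "continuous_on Q g"
    unfolding g_def by (intro continuous_on_vec_lambda continuous_intros contk contF)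
  moreover have "g \<in> Q \<rightarrow> Q"
  proof
    fix v assume v: "v \<in> Q"
    have "\<bar>e v k\<bar> \<le> 1" for k using v by (auto simp: e_def Q)
    then show "g v \<in> Q"
      by (auto simp: Q g_def intro!: near_id ix)
  qed
  moreover have "0 \<in> Q" by (simp add: Q)
  moreover have "compact Q" "convex Q" by (simp_all add: Q_def compact_cbox convex_box)
  ultimately obtain v where v: "g v = v"
    using brouwer[of Q g] by (metis empty_iff)
  have "F (e v) i = 0" if "i < CARD('n)" for i
  proof -
    have "g v $ b i = v $ b i" using v by simp
    then show ?thesis using that by (simp add: g_def bix e_def[of v i])
  qed
  then show ?thesis by blast
qed

section \<open>Affine arithmetic\<close>

text \<open>The form \<open>(c, l, e)\<close> stands for the affine function with constant term \<open>c\<close> and coefficients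
  \<open>l\<close> (the missing ones being zero), up to an error of at most \<open>e\<close> on the unit cube.\<close>
type_synonym affine_form = "int \<times> int list \<times> int"

fun lin :: "nat \<Rightarrow> int list \<Rightarrow> (nat \<Rightarrow> real) \<Rightarrow> real" where
  "lin k [] y = 0"
| "lin k (a # l) y = a * y k + lin (Suc k) l y"

fun ladd :: "int list \<Rightarrow> int list \<Rightarrow> int list" where
  "ladd [] m = m"
| "ladd l [] = l"
| "ladd (a # l) (b # m) = (a + b) # ladd l m"

definition lnorm :: "int list \<Rightarrow> int" where
  "lnorm l = sum_list (map abs l)"

lemma lin_ladd: "lin k (ladd l m) y = lin k l y + lin k m y"
  by (induction l m arbitrary: k rule: ladd.induct) (auto simp: algebra_simps)

lemma lin_scale: "lin k (map ((*) c) l) y = c * lin k l y"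
  by (induction l arbitrary: k) (auto simp: algebra_simps)

lemma lin_unit: "lin k (replicate i 0 @ [s]) y = s * y (k + i)"
  by (induction i arbitrary: k) auto

lemma lin_bound:
  assumes "\<And>k. \<bar>y k\<bar> \<le> 1"
  shows "\<bar>lin k l y\<bar> \<le> lnorm l"
proof (induction l arbitrary: k)
  case (Cons a l)
  have "\<bar>a * y k\<bar> \<le> \<bar>real_of_int a\<bar> * 1"
    unfolding abs_mult by (intro mult_left_mono assms) auto
  with Cons[of "Suc k"] show ?case by (simp add: lnorm_def)
qed (simp add: lnorm_def)

lemma continuous_on_lin: "continuous_on UNIV (lin k l)"
proof (induction l arbitrary: k)
  case (Cons a l)
  then show ?case
    by (auto intro!: continuous_intros continuous_on_product_coordinates)
qed auto

fun center :: "affine_form \<Rightarrow> (nat \<Rightarrow> real) \<Rightarrow> real" where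
  "center (c, l, e) y = c + lin 0 l y"

fun encloses :: "(nat \<Rightarrow> real) \<Rightarrow> affine_form \<Rightarrow> real \<Rightarrow> bool" where
  "encloses y (c, l, e) x \<longleftrightarrow> \<bar>x - (c + lin 0 l y)\<bar> \<le> e"

fun aff_add :: "affine_form \<Rightarrow> affine_form \<Rightarrow> affine_form" where
  "aff_add (c, l, e) (c', l', e') = (c + c', ladd l l', e + e')"

text \<open>Only terms of degree at most one are kept; the product of the two deviations from the
  constant terms goes into the error, bounded by the norms.\<close>

fun aff_mult :: "affine_form \<Rightarrow> affine_form \<Rightarrow> affine_form" where
  "aff_mult (c, l, e) (c', l', e') =
     (c * c', ladd (map ((*) c) l') (map ((*) c') l),
      \<bar>c\<bar> * e' + \<bar>c'\<bar> * e + (lnorm l + e) * (lnorm l' + e'))"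

lemma encloses_add:
  "encloses y a x \<Longrightarrow> encloses y b z \<Longrightarrow> encloses y (aff_add a b) (x + z)"
  by (cases a; cases b) (auto simp: lin_ladd)

lemma encloses_mult:
  assumes y: "\<And>k. \<bar>y k\<bar> \<le> 1" and a: "encloses y a x" and b: "encloses y b z"
  shows "encloses y (aff_mult a b) (x * z)"
proof -
  obtain c l e where [simp]: "a = (c, l, e)" by (cases a)
  obtain c' l' e' where [simp]: "b = (c', l', e')" by (cases b)
  define u v where "u = x - c" and "v = z - c'"
  have "\<bar>u - lin 0 l y\<bar> \<le> e" "\<bar>v - lin 0 l' y\<bar> \<le> e'"
    using a b by (auto simp: u_def v_def algebra_simps)
  note uv = this
  have "\<bar>u\<bar> \<le> lnorm l + e" "\<bar>v\<bar> \<le> lnorm l' + e'"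
    using uv lin_bound[of y, OF y, of 0 l] lin_bound[of y, OF y, of 0 l'] by (simp_all add: abs_le_iff)
  then have 1: "\<bar>u * v\<bar> \<le> (lnorm l + e) * (lnorm l' + e')"
    unfolding abs_mult of_int_mult by (intro mult_mono) auto
  have 2: "\<bar>c * (v - lin 0 l' y)\<bar> \<le> \<bar>c\<bar> * e'" "\<bar>c' * (u - lin 0 l y)\<bar> \<le> \<bar>c'\<bar> * e"
    using uv by (auto simp: abs_mult intro!: mult_left_mono)
  have "x * z - (c * c' + (c * lin 0 l' y + c' * lin 0 l y)) =
      c * (v - lin 0 l' y) + c' * (u - lin 0 l y) + u * v"
    by (simp add: u_def v_def algebra_simps)
  then show ?thesis
    using 1 2 by (simp add: lin_ladd lin_scale)
qed

fun sprod :: "real list \<Rightarrow> real list \<Rightarrow> real" where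
  "sprod (x # xs) (y # ys) = x * y + sprod xs ys"
| "sprod xs ys = 0"

fun aff_sprod :: "affine_form list \<Rightarrow> affine_form list \<Rightarrow> affine_form" where
  "aff_sprod (a # as) (b # bs) = aff_add (aff_mult a b) (aff_sprod as bs)"
| "aff_sprod as bs = (0, [], 0)"

text \<open>Subtracting \<open>s\<close> times the \<open>i\<close>-th variable before taking the
  norm lets the dominant diagonal coefficient cancel.\<close>

fun within_unit :: "nat \<Rightarrow> int \<Rightarrow> affine_form \<Rightarrow> bool" where
  "within_unit i s (c, l, e) \<longleftrightarrow> \<bar>c\<bar> + lnorm (ladd l (replicate i 0 @ [- s])) + e \<le> s"

lemma within_unit:
  assumes y: "\<And>k. \<bar>y k\<bar> \<le> 1" and "within_unit i s a" "encloses y a x" "s > 0"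
  shows "\<bar>y i - x / s\<bar> \<le> 1"
proof -
  obtain c l e where a: "a = (c, l, e)" by (cases a)
  have "\<bar>lin 0 l y - s * y i\<bar> \<le> lnorm (ladd l (replicate i 0 @ [- s]))"
    using lin_bound[OF y, of 0 "ladd l (replicate i 0 @ [- s])"] by (simp add: lin_ladd lin_unit)
  moreover have "\<bar>real_of_int c\<bar> + lnorm (ladd l (replicate i 0 @ [- s])) + e \<le> s"
    using assms(2) unfolding a within_unit.simps of_int_le_iff[symmetric, where 'a=real] by simp
  ultimately have "\<bar>s * y i - x\<bar> \<le> s"
    using assms(3) by (simp add: a)
  moreover have "s * y i - x = s * (y i - x / s)" using assms(4) by (simp add: algebra_simps)
  ultimately show ?thesis using assms(4) by (simp add: abs_mult)
qed

lemma encloses_sprod: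
  assumes y: "\<And>k. \<bar>y k\<bar> \<le> 1"
  shows "list_all2 (encloses y) as xs \<Longrightarrow> list_all2 (encloses y) bs zs \<Longrightarrow>
    encloses y (aff_sprod as bs) (sprod xs zs)"
proof (induction as bs arbitrary: xs zs rule: aff_sprod.induct)
  case (1 a as b bs)
  then show ?case
    by (auto simp: list_all2_Cons1 intro!: encloses_add encloses_mult[OF y])
qed (auto simp: list_all2_Cons1)

section \<open>The polynomial system\<close>

text \<open>For orthonormal pairs this is the trace of the product of the two projections; the
  bracketing mirrors \<open>aff_quad\<close>.\<close>

definition quad :: "real list \<Rightarrow> real list \<Rightarrow> real list \<Rightarrow> real list \<Rightarrow> real" where
  "quad p q r s = (sprod p r * sprod p r + sprod p s * sprod p s) +
    (sprod q r * sprod q r + sprod q s * sprod q s)"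

definition aff_quad ::
  "affine_form list \<Rightarrow> affine_form list \<Rightarrow> affine_form list \<Rightarrow> affine_form list \<Rightarrow> affine_form" where
  "aff_quad p q r s =
    (let sq = (\<lambda>a. aff_mult a a) in
     aff_add (aff_add (sq (aff_sprod p r)) (sq (aff_sprod p s)))
       (aff_add (sq (aff_sprod q r)) (sq (aff_sprod q s))))"

lemma encloses_quad:
  assumes "\<And>k. \<bar>y k\<bar> \<le> 1" "list_all2 (encloses y) as p" "list_all2 (encloses y) bs q"
    "list_all2 (encloses y) cs r" "list_all2 (encloses y) ds s"
  shows "encloses y (aff_quad as bs cs ds) (quad p q r s)"
  unfolding aff_quad_def quad_def Let_def
  by (intro encloses_add encloses_mult encloses_sprod assms)

text \<open>Bases are scaled by \<open>10 ^ 5\<close>, so that all data are integers: an inner product \<open>x\<close> of unit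
  vectors becomes \<open>10 ^ 10 * x\<close>, and the trace \<open>17 / 25\<close> becomes \<open>68 * 10 ^ 18\<close>.\<close>
definition pair_residuals :: "real list \<Rightarrow> real list \<Rightarrow> real \<Rightarrow> real \<Rightarrow> real list" where
  "pair_residuals p q u v =
    [sprod p p + - (10 ^ 10),
     sprod q q + - (10 ^ 10),
     sprod p q,
     (sprod p (rotate 1 p) + sprod q (rotate 1 q)) + - (10 ^ 10 * u),
     (sprod p (rotate 2 p) + sprod q (rotate 2 q)) + - (10 ^ 10 * v),
     quad p q (rotate 1 p) (rotate 1 q) + - (68 * 10 ^ 18)]"

text \<open>The trace for shift 4 follows from the other four, because the diagonal sums fix the
  total over all shifts. This keeps the system square.\<close>

definition cross_residuals :: "real list \<Rightarrow> real list \<Rightarrow> real list \<Rightarrow> real list \<Rightarrow> real list" where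
  "cross_residuals p q r s =
    map (\<lambda>k. quad p q (rotate k r) (rotate k s) + - (68 * 10 ^ 18)) [0, 1, 2, 3]"

text \<open>The forms \<open>u\<close> and \<open>v\<close> stand for the negated scaled diagonal
  sums; these are irrational and therefore enter as enclosures.\<close>

definition aff_pair_residuals ::
  "affine_form list \<Rightarrow> affine_form list \<Rightarrow> affine_form \<Rightarrow> affine_form \<Rightarrow> affine_form list" where
  "aff_pair_residuals p q u v =
    [aff_add (aff_sprod p p) (- (10 ^ 10), [], 0),
     aff_add (aff_sprod q q) (- (10 ^ 10), [], 0),
     aff_sprod p q,
     aff_add (aff_add (aff_sprod p (rotate 1 p)) (aff_sprod q (rotate 1 q))) u,
     aff_add (aff_add (aff_sprod p (rotate 2 p)) (aff_sprod q (rotate 2 q))) v,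
     aff_add (aff_quad p q (rotate 1 p) (rotate 1 q)) (- (68 * 10 ^ 18), [], 0)]"

definition aff_cross_residuals ::
  "affine_form list \<Rightarrow> affine_form list \<Rightarrow> affine_form list \<Rightarrow> affine_form list \<Rightarrow> affine_form list" where
  "aff_cross_residuals p q r s =
    map (\<lambda>k. aff_add (aff_quad p q (rotate k r) (rotate k s)) (- (68 * 10 ^ 18), [], 0)) [0, 1, 2, 3]"

lemma encloses_const: "\<bar>x - real_of_int c\<bar> \<le> e \<Longrightarrow> encloses y (c, [], e) x"
  by simp

lemma list_all2_rotate: "list_all2 P xs ys \<Longrightarrow> list_all2 P (rotate k xs) (rotate k ys)"
proof (induction k)
  case (Suc k)
  then have "list_all2 P (rotate k xs) (rotate k ys)" by simp
  then show ?case
    by (cases "rotate k xs"; cases "rotate k ys") (auto intro: list_all2_appendI)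
qed simp

lemma encloses_pair_residuals:
  assumes "\<And>k. \<bar>y k\<bar> \<le> 1" "list_all2 (encloses y) as p" "list_all2 (encloses y) bs q"
    "encloses y a (- (10 ^ 10 * u))" "encloses y b (- (10 ^ 10 * v))"
  shows "list_all2 (encloses y) (aff_pair_residuals as bs a b) (pair_residuals p q u v)"
  unfolding aff_pair_residuals_def pair_residuals_def
  by (intro list_all2_Cons[THEN iffD2] conjI encloses_add encloses_sprod encloses_quad
      list_all2_rotate encloses_const assms list_all2_Nil[THEN iffD2]) auto

lemma encloses_cross_residuals:
  assumes "\<And>k. \<bar>y k\<bar> \<le> 1" "list_all2 (encloses y) as p" "list_all2 (encloses y) bs q"
    "list_all2 (encloses y) cs r" "list_all2 (encloses y) ds s"
  shows "list_all2 (encloses y) (aff_cross_residuals as bs cs ds) (cross_residuals p q r s)"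
  unfolding aff_cross_residuals_def cross_residuals_def list_all2_map1 list_all2_map2
  by (intro list_all2_refl encloses_add encloses_quad list_all2_rotate encloses_const assms) auto

text \<open>The required sums of the entries of the projections along the first and the second cyclic
  diagonal, with \<open>t = 1\<close> for \<open>A\<close> and \<open>t = -1\<close> for \<open>B\<close>. Trace \<open>17 / 25\<close> with the invariant plane
  is one linear equation in these two numbers, and the sum of the traces over an orbit fixes their
  sum of squares.\<close>
definition diag_sum1 :: "real \<Rightarrow> real" where
  "diag_sum1 t = (1 - sqrt 5 + t * sqrt 11 * (1 + sqrt 5)) / 20"

definition diag_sum2 :: "real \<Rightarrow> real" where
  "diag_sum2 t = (1 + sqrt 5 + t * sqrt 11 * (sqrt 5 - 1)) / 20"

text \<open>The constant terms are the approximate solution, the coefficients are 60 times the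
  approximate inverse of the Jacobian matrix; the four rows without coefficients are the frozen
  coordinates. Hence the \<open>i\<close>-th residual is close to a multiple of the \<open>i\<close>-th variable.\<close>
definition form_p :: "affine_form list" where
  "form_p =
    [(21000, [12, 30, - 21, 30, 31, - 39, 3, 2, - 4, 3, 1, 2, - 3, - 1, - 1, - 7], 0),
     (22062, [- 45, - 7, - 31, - 37, 11, 54, - 20, 3, - 19, - 18, 2, - 2, 8, - 3, 22, - 20], 0),
     (83012, [33, - 19, - 11, - 6, - 9, - 6, - 17, - 5, 2, - 15, - 1, - 5, 11, 1, 13, 10], 0),
     (38366, [45, 42, 23, - 8, - 12, 9, 61, 14, - 1, 52, 2, 18, - 38, - 3, - 49, - 26], 0),
     (26633, [- 26, - 19, 43, 37, 13, - 9, - 21, - 10, 13, - 17, - 2, - 9, 16, 4, 13, 27], 0)]"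

definition form_q :: "affine_form list" where
  "form_q =
    [(- 34213, [- 4, 30, 18, 24, - 14, - 4, 2, 13, - 34, 1, 5, 7, - 9, - 7, 9, - 52], 0),
     (- 50776, [20, 21, 4, - 117, 23, 61, 41, 19, - 24, 34, 5, 17, - 31, - 7, - 25, - 53], 0),
     (4000, [], 0),
     (- 14600, [], 0),
     (77602, [11, 66, 11, - 66, 9, 38, 28, 18, - 31, 22, 5, 14, - 24, - 8, - 13, - 57], 0)]"

definition form_r :: "affine_form list" where
  "form_r =
    [(30829, [- 26, - 2, - 1, - 12, 12, 14, 4, - 5, - 15, - 59, - 27, - 26, 0, 17, 10, - 7], 0),
     (- 19398, [- 7, - 49, - 17, 111, - 23, - 66, - 75, - 30, 9, - 4, - 7, 15, 70, 15, 5, 39], 0),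
     (- 16117, [- 5, 32, 11, - 80, 20, 50, 19, - 17, - 50, 20, - 24, 31, - 47, - 3, 0, - 29], 0),
     (12188, [25, 8, 3, - 1, - 8, - 6, 12, 0, 41, - 4, - 3, 8, - 8, - 18, - 10, 2], 0),
     (- 90912, [- 3, 5, 2, - 14, 4, 9, - 18, 7, 7, - 23, - 4, - 16, - 8, 1, 1, - 5], 0)]"

definition form_s :: "affine_form list" where
  "form_s =
    [(- 14960, [- 80, - 10, - 3, - 29, 34, 40, - 55, - 66, - 13, 21, - 19, 40, 5, 56, 30, - 19], 0),
     (- 19164, [6, - 18, - 6, 45, - 12, - 29, - 46, - 3, - 25, - 6, 47, 14, 26, 0, - 1, 17], 0),
     (- 50700, [], 0),
     (80530, [- 14, - 6, - 2, 5, 3, 0, - 21, 24, - 8, 2, 7, 11, 7, 10, 5, 0], 0),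
     (18800, [], 0)]"

text \<open>The four long constants are rounded values of \<open>- (10 ^ 10)\<close> times the
  diagonal sums; the error \<open>10 ^ 5\<close> leaves room for six-decimal bounds on the
  roots.\<close>

definition forms :: "affine_form list" where
  "forms =
    aff_pair_residuals form_p form_q (- 4748377650, [], 10 ^ 5) (- 3667820837, [], 10 ^ 5) @
    aff_pair_residuals form_r form_s (5984445627, [], 10 ^ 5) (431752860, [], 10 ^ 5) @
    aff_cross_residuals form_p form_q form_r form_s"

text \<open>A coordinate change in units of \<open>10 ^ -5\<close> is multiplied by
  \<open>10 ^ 10\<close> in a quadratic residual and by \<open>10 ^ 20\<close> in a quartic one;
  with the factor 60 of the coefficients this gives \<open>a\<close> and \<open>b\<close>.\<close>

definition scales :: "int list" where
  "scales =
    (let a = 60 * 10 ^ 5; b = 60 * 10 ^ 15 in [a, a, a, a, a, b, a, a, a, a, a, b, b, b, b, b])"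

definition residuals :: "(nat \<Rightarrow> real) \<Rightarrow> real list" where
  "residuals y =
    (let p = map (\<lambda>a. center a y) form_p; q = map (\<lambda>a. center a y) form_q;
         r = map (\<lambda>a. center a y) form_r; s = map (\<lambda>a. center a y) form_s
     in pair_residuals p q (diag_sum1 1) (diag_sum2 1) @ pair_residuals r s (diag_sum1 (-1)) (diag_sum2 (-1)) @
        cross_residuals p q r s)"

section \<open>Numerical verification and the exact zero\<close>

text \<open>The computational core: the residual at the center, the defect of the approximate
  inverse and the terms of higher order together stay below each scale.\<close>

lemma forms_within_unit:
  "list_all (\<lambda>(i, s, a). within_unit i s a) (zip [0..<16] (zip scales forms))"
  by code_simp

lemma diag_sum_bounds:
  "\<bar>10 ^ 10 * diag_sum1 1 - 4748377650\<bar> \<le> 10 ^ 5"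
  "\<bar>10 ^ 10 * diag_sum2 1 - 3667820837\<bar> \<le> 10 ^ 5"
  "\<bar>10 ^ 10 * diag_sum1 (-1) + 5984445627\<bar> \<le> 10 ^ 5"
  "\<bar>10 ^ 10 * diag_sum2 (-1) + 431752860\<bar> \<le> 10 ^ 5"
proof -
  have sq: "c \<le> sqrt x \<and> sqrt x \<le> d" if "c\<^sup>2 \<le> x" "x \<le> d\<^sup>2" "0 \<le> d" for c d x :: real
    using that by (simp add: real_le_rsqrt real_le_lsqrt)
  \<comment> \<open>With the product of roots merged into \<open>sqrt 55\<close>, the diagonal sums
    are linear in three roots, so bounds on each root suffice.\<close>
  have "sqrt 11 * sqrt 5 = sqrt 55" by (simp flip: real_sqrt_mult)
  then have diag_sum:
    "diag_sum1 t = (1 - sqrt 5 + t * (sqrt 11 + sqrt 55)) / 20"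
    "diag_sum2 t = (1 + sqrt 5 + t * (sqrt 55 - sqrt 11)) / 20" for t
    by (simp_all add: diag_sum1_def diag_sum2_def algebra_simps)
  show
    "\<bar>10 ^ 10 * diag_sum1 1 - 4748377650\<bar> \<le> 10 ^ 5"
    "\<bar>10 ^ 10 * diag_sum2 1 - 3667820837\<bar> \<le> 10 ^ 5"
    "\<bar>10 ^ 10 * diag_sum1 (-1) + 5984445627\<bar> \<le> 10 ^ 5"
    "\<bar>10 ^ 10 * diag_sum2 (-1) + 431752860\<bar> \<le> 10 ^ 5"
    using sq[of "2236067 / 10 ^ 6" 5 "2236068 / 10 ^ 6"]
      sq[of "3316624 / 10 ^ 6" 11 "3316625 / 10 ^ 6"]
      sq[of "7416198 / 10 ^ 6" 55 "7416199 / 10 ^ 6"]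
    unfolding diag_sum abs_le_iff by (simp_all add: power2_eq_square field_simps)
qed

lemma encloses_center: "list_all (\<lambda>(c, l, e). 0 \<le> e) as \<Longrightarrow>
  list_all2 (encloses y) as (map (\<lambda>a. center a y) as)"
  by (induction as) auto

lemma encloses_residuals:
  assumes y: "\<And>k. \<bar>y k\<bar> \<le> 1"
  shows "list_all2 (encloses y) forms (residuals y)"
proof -
  have "list_all2 (encloses y) as (map (\<lambda>a. center a y) as)"
    if "as \<in> {form_p, form_q, form_r, form_s}" for as
    using that by (intro encloses_center) (auto simp: form_p_def form_q_def form_r_def form_s_def)
  then show ?thesis
    using diag_sum_bounds unfolding forms_def residuals_def Let_def
    by (intro list_all2_appendI encloses_pair_residuals encloses_cross_residuals encloses_const y)
      (auto simp: algebra_simps abs_minus_commute)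
qed

lemma continuous_on_sprod:
  "\<forall>a\<in>set as. continuous_on S (f a) \<Longrightarrow> \<forall>b\<in>set bs. continuous_on S (f b) \<Longrightarrow>
    continuous_on S (\<lambda>y. sprod (map (\<lambda>a. f a y) as) (map (\<lambda>b. f b y) bs))"
  by (induction as bs rule: list_induct2') (auto intro!: continuous_intros)

lemma length_residuals: "length (residuals y) = 16"
  by (simp add: residuals_def Let_def pair_residuals_def cross_residuals_def)

lemma continuous_on_residuals:
  assumes "i < 16"
  shows "continuous_on UNIV (\<lambda>y. residuals y ! i)"
proof -
  have center: "continuous_on UNIV (center a)" for a
  proof -
    have "center a = (\<lambda>y. fst a + lin 0 (fst (snd a)) y)"
      by (cases a) auto
    then show ?thesis by (auto intro!: continuous_intros continuous_on_lin)
  qed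
  have sprod: "continuous_on UNIV
      (\<lambda>y. sprod (map (\<lambda>a. center a y) as) (map (\<lambda>a. center a y) bs))" for as bs
    by (intro continuous_on_sprod ballI center)
  have quad: "continuous_on UNIV
      (\<lambda>y. quad (map (\<lambda>a. center a y) as) (map (\<lambda>a. center a y) bs)
        (map (\<lambda>a. center a y) cs) (map (\<lambda>a. center a y) ds))" for as bs cs ds
    unfolding quad_def by (intro continuous_intros sprod)
  \<comment> \<open>Listing all 16 components turns the claim into a finite conjunction about sums
    of \<open>sprod\<close> and \<open>quad\<close> terms.\<close>
  define fs where "fs = map (\<lambda>i y. residuals y ! i) [0..<16]"
  have "list_all (continuous_on UNIV) fs"
    unfolding fs_def residuals_def pair_residuals_def cross_residuals_def Let_def rotate_map
    by (simp add: upt_rec numeral_2_eq_2 numeral_3_eq_3, intro conjI continuous_intros sprod quad)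
  then show ?thesis using assms by (simp add: fs_def list_all_iff)
qed

lemma residuals_zero: "\<exists>y. \<forall>x\<in>set (residuals y). x = 0"
proof -
  have len: "length scales = 16" "length forms = 16"
    by (simp_all add: scales_def forms_def aff_pair_residuals_def aff_cross_residuals_def Let_def)
  have "\<forall>s\<in>set scales. s > 0" by (auto simp: scales_def Let_def)
  then have pos: "scales ! i > 0" if "i < 16" for i
    using len that by simp
  \<comment> \<open>The numeral type 16 supplies the dimension of the cube; dividing by the scales
    makes the system close to the identity.\<close>
  have "\<exists>y. \<forall>i < CARD(16). residuals y ! i / scales ! i = 0"
  proof (rule zero_in_cube)
    show "continuous_on UNIV (\<lambda>y. residuals y ! i / scales ! i)" if "i < CARD(16)" for i
      using that pos[of i] by (intro continuous_intros continuous_on_residuals) auto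
    show "\<bar>y i - residuals y ! i / scales ! i\<bar> \<le> 1"
      if y: "\<And>k. \<bar>y k\<bar> \<le> 1" and i: "i < CARD(16)" for y i
    proof (rule within_unit[OF y])
      show "within_unit i (scales ! i) (forms ! i)"
        using forms_within_unit i len by (simp add: list_all_length)
      show "encloses y (forms ! i) (residuals y ! i)"
        using encloses_residuals[OF y] i len by (simp add: list_all2_conv_all_nth)
      show "scales ! i > 0" using pos i by simp
    qed
  qed
  then obtain y where y: "\<And>i. i < 16 \<Longrightarrow> residuals y ! i / scales ! i = 0" by auto
  have "residuals y ! i = 0" if "i < 16" for i
    using y[OF that] pos[OF that] by simp
  then show ?thesis by (auto simp: in_set_conv_nth length_residuals intro!: exI[of _ y])
qed

section \<open>Planes and the cyclic shift\<close>

lemma UNIV_5: "(UNIV :: 5 set) = {0, 1, 2, 3, 4}"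
proof -
  have "x \<in> {0, 1, 2, 3, 4}" for x :: 5
  proof (induct x)
    case (of_int z)
    then have "z = 0 \<or> z = 1 \<or> z = 2 \<or> z = 3 \<or> z = 4" by simp arith
    then show ?case by auto
  qed
  then show ?thesis by blast
qed

lemma sum_5: "sum f (UNIV :: 5 set) = f 0 + f 1 + f 2 + f 3 + f 4"
  unfolding UNIV_5 by (simp add: add.assoc)

lemma forall_5: "(\<forall>i::5. P i) \<longleftrightarrow> P 0 \<and> P 1 \<and> P 2 \<and> P 3 \<and> P 4"
  using UNIV_5 by (metis UNIV_I empty_iff insert_iff)

lemma uminus_5: "- 1 = (4 :: 5)" "- 2 = (3 :: 5)"
  by simp_all

lemma numeral_mod_5: "(5 :: 5) = 0" "(6 :: 5) = 1"
  by simp_all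

section \<open>Projections onto planes and the action of the shift\<close>

definition shift :: "5 \<Rightarrow> real^5 \<Rightarrow> real^5" where
  "shift k v = (\<chi> i. v $ (i + k))"

text \<open>The matrix p p^T + q q^T, which is the orthogonal projection onto the span when the pair
  is orthonormal.\<close>

definition plane :: "real^'n \<Rightarrow> real^'n \<Rightarrow> real^'n^'n" where
  "plane p q = (\<chi> i j. p $ i * p $ j + q $ i * q $ j)"

definition orthonormal :: "real^'n \<Rightarrow> real^'n \<Rightarrow> bool" where
  "orthonormal p q \<longleftrightarrow> p \<bullet> p = 1 \<and> q \<bullet> q = 1 \<and> p \<bullet> q = 0"

lemma plane_mult_vec: "plane p q *v x = (p \<bullet> x) *\<^sub>R p + (q \<bullet> x) *\<^sub>R q"
  by (simp add: vec_eq_iff plane_def matrix_vector_mult_def inner_vec_def distrib_right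
      sum.distrib sum_distrib_left sum_distrib_right) (simp add: mult_ac)

lemma trace_plane_mult:
  "trace (plane p q ** plane r s) = (p \<bullet> r)\<^sup>2 + (p \<bullet> s)\<^sup>2 + (q \<bullet> r)\<^sup>2 + (q \<bullet> s)\<^sup>2"
proof -
  have "trace (plane p q ** plane r s) = (\<Sum>i\<in>UNIV. \<Sum>j\<in>UNIV.
      (p $ i * r $ i) * (p $ j * r $ j) + (p $ i * s $ i) * (p $ j * s $ j) +
      (q $ i * r $ i) * (q $ j * r $ j) + (q $ i * s $ i) * (q $ j * s $ j))"
    by (simp add: trace_def matrix_matrix_mult_def plane_def algebra_simps)
  then show ?thesis
    by (simp add: sum.distrib inner_vec_def power2_eq_square sum_product)
qed

lemma plane_in_grassmannian:
  fixes p q :: "real^'n"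
  assumes "orthonormal p q"
  shows "plane p q \<in> grassmannian 2"
proof -
  have pq: "p \<bullet> p = 1" "q \<bullet> q = 1" "p \<bullet> q = 0" "q \<bullet> p = 0"
    using assms by (auto simp: orthonormal_def inner_commute)
  have "plane p q ** plane p q = plane p q"
    unfolding matrix_eq by (simp add: plane_mult_vec pq inner_add_right flip: matrix_vector_mul_assoc)
  moreover have "transpose (plane p q) = plane p q"
    by (simp add: transpose_def plane_def vec_eq_iff mult.commute)
  moreover have "rank (plane p q) = 2"
  proof -
    have "range ((*v) (plane p q)) = span {p, q}"
    proof (intro equalityI subsetI)
      fix x assume "x \<in> span {p, q}"
      then obtain a b where x: "x = a *\<^sub>R p + b *\<^sub>R q"
        by (auto simp: span_insert algebra_simps)
      have "plane p q *v x = x"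
        by (simp add: x plane_mult_vec inner_add_right pq)
      then show "x \<in> range ((*v) (plane p q))" by (metis rangeI)
    qed (auto simp: plane_mult_vec intro!: span_add span_scale intro: span_base)
    moreover have "p \<noteq> q" using pq by auto
    moreover have "independent {p, q}"
      by (rule pairwise_orthogonal_independent) (use pq in \<open>auto simp: pairwise_def orthogonal_def\<close>)
    ultimately show ?thesis
      by (simp add: rank_dim_range dim_eq_card_independent)
  qed
  ultimately show ?thesis by (simp add: grassmannian_def)
qed

lemma sum_shift: "(\<Sum>i\<in>UNIV. f (i + k)) = sum f UNIV" for k :: 5
  by (rule sum.reindex_bij_betw) (rule bij_plus_right)

lemma inner_shift_shift: "shift a p \<bullet> shift b q = p \<bullet> shift (b - a) q"
  using sum_shift[of "\<lambda>i. p $ i * q $ (i + (b - a))" a]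
  by (simp add: inner_vec_def shift_def algebra_simps)

lemma shift_0: "shift 0 p = p"
  by (simp add: shift_def vec_eq_iff)

lemma shift_shift: "shift a (shift b p) = shift (a + b) p"
  by (simp add: shift_def vec_eq_iff algebra_simps)

lemma shift_scaleR: "shift k (c *\<^sub>R p) = c *\<^sub>R shift k p"
  by (simp add: shift_def vec_eq_iff)

lemma shift_action_nth: "shift_action M $ i $ j = M $ (i + 1) $ (j + 1)"
  by (simp add: shift_action_def cyc_shift_def transpose_def matrix_matrix_mult_def
      if_distrib[of "\<lambda>x. x * _"] if_distrib[of "\<lambda>x. _ * x"] cong: if_cong)

lemma shift_action_plane: "shift_action (plane p q) = plane (shift 1 p) (shift 1 q)"
  by (simp add: vec_eq_iff shift_action_nth plane_def shift_def)

text \<open>Both sides are the sum of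
  \<open>p $ i * q $ (i + d) * r $ (i + k) * s $ (i + d + k)\<close> over all i, d and k, summed in
  different orders.\<close>

lemma sum_inner_shift:
  "(\<Sum>k\<in>UNIV. (p \<bullet> shift k r) * (q \<bullet> shift k s)) =
   (\<Sum>d\<in>UNIV. (p \<bullet> shift d q) * (r \<bullet> shift d s))"
proof -
  define X where "X i d k = p $ i * q $ (i + d) * (r $ (i + k) * s $ (i + d + k))" for i d k
  have inner: "v \<bullet> shift k w = (\<Sum>j\<in>UNIV. v $ (i + j) * w $ (i + j + k))" for v w k i
    using sum_shift[of "\<lambda>j. v $ j * w $ (j + k)" i]
    by (simp add: inner_vec_def shift_def add.commute)
  have "(p \<bullet> shift k r) * (q \<bullet> shift k s) = (\<Sum>i\<in>UNIV. \<Sum>d\<in>UNIV. X i d k)" for k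
  proof -
    have "(p \<bullet> shift k r) * (q \<bullet> shift k s) =
        (\<Sum>i\<in>UNIV. p $ i * r $ (i + k) * (q \<bullet> shift k s))"
      by (simp add: inner_vec_def shift_def sum_distrib_right)
    also have "\<dots> = (\<Sum>i\<in>UNIV. \<Sum>d\<in>UNIV. X i d k)"
    proof (rule sum.cong)
      fix i show "p $ i * r $ (i + k) * (q \<bullet> shift k s) = (\<Sum>d\<in>UNIV. X i d k)"
        unfolding inner[of q k s i] by (simp add: X_def sum_distrib_left mult_ac)
    qed simp
    finally show ?thesis .
  qed
  moreover have "(p \<bullet> shift d q) * (r \<bullet> shift d s) = (\<Sum>i\<in>UNIV. \<Sum>k\<in>UNIV. X i d k)" for d
  proof -
    have "(p \<bullet> shift d q) * (r \<bullet> shift d s) =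
        (\<Sum>i\<in>UNIV. p $ i * q $ (i + d) * (r \<bullet> shift d s))"
      by (simp add: inner_vec_def shift_def sum_distrib_right)
    also have "\<dots> = (\<Sum>i\<in>UNIV. \<Sum>k\<in>UNIV. X i d k)"
    proof (rule sum.cong)
      fix i show "p $ i * q $ (i + d) * (r \<bullet> shift d s) = (\<Sum>k\<in>UNIV. X i d k)"
        unfolding inner[of r d s i] by (simp add: X_def sum_distrib_left add_ac)
    qed simp
    finally show ?thesis .
  qed
  moreover have "(\<Sum>k\<in>UNIV. \<Sum>i\<in>UNIV. \<Sum>d\<in>UNIV. X i d k) =
      (\<Sum>d\<in>UNIV. \<Sum>i\<in>UNIV. \<Sum>k\<in>UNIV. X i d k)"
  proof -
    have "(\<Sum>k\<in>UNIV. \<Sum>i\<in>UNIV. \<Sum>d\<in>UNIV. X i d k) = (\<Sum>i\<in>UNIV. \<Sum>k\<in>UNIV. \<Sum>d\<in>UNIV. X i d k)"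
      by (rule sum.swap)
    also have "\<dots> = (\<Sum>i\<in>UNIV. \<Sum>d\<in>UNIV. \<Sum>k\<in>UNIV. X i d k)"
      by (intro sum.cong refl sum.swap)
    also have "\<dots> = (\<Sum>d\<in>UNIV. \<Sum>i\<in>UNIV. \<Sum>k\<in>UNIV. X i d k)"
      by (rule sum.swap)
    finally show ?thesis .
  qed
  ultimately show ?thesis by simp
qed

section \<open>Traces between shift orbits\<close>

text \<open>The sum of the entries of \<open>plane p q\<close> along its \<open>d\<close>-th cyclic
  diagonal.\<close>

definition corr :: "real^5 \<Rightarrow> real^5 \<Rightarrow> 5 \<Rightarrow> real" where
  "corr p q d = p \<bullet> shift d p + q \<bullet> shift d q"

definition overlap :: "real^5 \<Rightarrow> real^5 \<Rightarrow> real^5 \<Rightarrow> real^5 \<Rightarrow> 5 \<Rightarrow> real" where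
  "overlap p q r s k =
    (p \<bullet> shift k r)\<^sup>2 + (p \<bullet> shift k s)\<^sup>2 + (q \<bullet> shift k r)\<^sup>2 + (q \<bullet> shift k s)\<^sup>2"

text \<open>Shifts are orthogonal, so only the difference of the two shifts matters.\<close>

lemma trace_shifted_planes:
  "trace (plane (shift a p) (shift a q) ** plane (shift b r) (shift b s)) = overlap p q r s (b - a)"
  by (simp add: trace_plane_mult overlap_def inner_shift_shift)

lemma inner_shift_minus: "p \<bullet> shift (- k) q = q \<bullet> shift k p"
  using inner_shift_shift[of k p 0 q] by (simp add: shift_0 inner_commute)

lemma corr_minus: "corr p q (- d) = corr p q d"
  by (simp add: corr_def inner_shift_minus)

lemma corr_0: "orthonormal p q \<Longrightarrow> corr p q 0 = 2"
  by (simp add: corr_def shift_0 orthonormal_def)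

lemma corr_shift: "corr (shift k p) (shift k q) d = corr p q d"
  by (simp add: corr_def shift_shift inner_shift_shift)

lemma overlap_minus: "overlap p q r s (- k) = overlap r s p q k"
  by (simp add: overlap_def inner_shift_minus)

text \<open>By \<open>sum_inner_shift\<close> the total is the sum of products of diagonal sums; the
  main diagonals give 2 * 2, and the diagonals d and -d agree.\<close>

lemma sum_overlap:
  assumes "orthonormal p q" "orthonormal r s"
  shows "overlap p q r s 0 + overlap p q r s 1 + overlap p q r s 2 + overlap p q r s 3 +
      overlap p q r s 4 = 4 + 2 * corr p q 1 * corr r s 1 + 2 * corr p q 2 * corr r s 2"
proof -
  have "sum (overlap p q r s) UNIV = (\<Sum>d\<in>UNIV. corr p q d * corr r s d)"
    by (simp add: overlap_def corr_def power2_eq_square sum.distrib sum_inner_shift algebra_simps)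
  moreover have "corr p q 3 = corr p q 2" "corr p q 4 = corr p q 1"
      "corr r s 3 = corr r s 2" "corr r s 4 = corr r s 1"
    using corr_minus[of _ _ 2] corr_minus[of _ _ 1] unfolding uminus_5 by blast+
  ultimately show ?thesis
    using assms by (simp add: sum_5 corr_0)
qed

text \<open>The five traces add up to 118/25. Removing the trace 2 of the plane with itself leaves 4
  * 17/25, and shifts k and -k give equal traces, so the value at 1 determines the value at
  2.\<close>

lemma overlap_orbit:
  assumes "orthonormal p q" "(corr p q 1)\<^sup>2 + (corr p q 2)\<^sup>2 = 9 / 25"
    "overlap p q p q 1 = 17 / 25" "k \<noteq> 0"
  shows "overlap p q p q k = 17 / 25"
proof -
  have "overlap p q p q 3 = overlap p q p q 2" "overlap p q p q 4 = overlap p q p q 1"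
    using overlap_minus[of p q p q 2] overlap_minus[of p q p q 1] unfolding uminus_5 by blast+
  moreover have "overlap p q p q 0 = 2"
    using assms(1) by (simp add: overlap_def orthonormal_def shift_0 inner_commute)
  ultimately have "\<forall>k. k \<noteq> 0 \<longrightarrow> overlap p q p q k = 17 / 25"
    using sum_overlap[OF assms(1,1)] assms(2,3) unfolding forall_5
    by (simp add: power2_eq_square)
  then show ?thesis using assms(4) by blast
qed

text \<open>The five traces add up to 4 - 3/5 = 5 * 17/25, so four of them determine the
  fifth.\<close>

lemma overlap_cross:
  assumes "orthonormal p q" "orthonormal r s"
    "corr p q 1 * corr r s 1 + corr p q 2 * corr r s 2 = - 3 / 10"
    "\<And>k. k \<in> {0, 1, 2, 3} \<Longrightarrow> overlap p q r s k = 17 / 25"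
  shows "overlap p q r s k = 17 / 25"
proof -
  have "\<forall>k. overlap p q r s k = 17 / 25"
    using sum_overlap[OF assms(1,2)] assms(3) assms(4)[of 0] assms(4)[of 1] assms(4)[of 2] assms(4)[of 3]
    unfolding forall_5 by simp
  then show ?thesis by blast
qed

text \<open>The planes are distinct because equal ones would have trace product 2, which differs
  from the prescribed value.\<close>

lemma tight_simplex_range:
  fixes u v :: "'i::finite \<Rightarrow> real^'n"
  assumes orth: "\<And>i. orthonormal (u i) (v i)"
    and tr: "\<And>i j. i \<noteq> j \<Longrightarrow> trace (plane (u i) (v i) ** plane (u j) (v j)) =
      2 * (real CARD('i) * 2 - real CARD('n)) / (real CARD('n) * (real CARD('i) - 1))"
    and ne: "2 * (real CARD('i) * 2 - real CARD('n)) / (real CARD('n) * (real CARD('i) - 1)) \<noteq> 2"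
  shows "tight_simplex 2 CARD('i) (range (\<lambda>i. plane (u i) (v i)))"
proof -
  have "trace (plane (u i) (v i) ** plane (u i) (v i)) = 2" for i
    using orth[of i] by (simp add: trace_plane_mult orthonormal_def inner_commute)
  then have "inj (\<lambda>i. plane (u i) (v i))"
    using tr ne by (metis (no_types, lifting) injI)
  then have "card (range (\<lambda>i. plane (u i) (v i))) = CARD('i)"
    by (rule card_image)
  then show ?thesis
    unfolding tight_simplex_def
  proof (intro conjI ballI impI)
    fix P Q assume "P \<in> range (\<lambda>i. plane (u i) (v i))" "Q \<in> range (\<lambda>i. plane (u i) (v i))" "P \<noteq> Q"
    then obtain i j where "P = plane (u i) (v i)" "Q = plane (u j) (v j)" "i \<noteq> j" by auto
    then show "trace (P ** Q) = real 2 * (real CARD('i) * real 2 - real CARD('n)) /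
        (real CARD('n) * (real CARD('i) - 1))"
      using tr[of i j] by simp
  qed (auto intro: plane_in_grassmannian orth)
qed

section \<open>The shift-invariant plane\<close>

text \<open>The values of cos (2 \<pi> i / 5) in closed form, normalized to length 1;
  \<open>sin_vec\<close> does the same for the sine.\<close>

definition cos_vec :: "real^5" where
  "cos_vec = sqrt (2 / 5) *\<^sub>R (\<chi> i. if i = 0 then 1 else if i = 1 \<or> i = 4 then (sqrt 5 - 1) / 4
     else - (sqrt 5 + 1) / 4)"

definition sin_vec :: "real^5" where
  "sin_vec = sqrt (2 / 5) *\<^sub>R (\<chi> i. if i = 0 then 0
     else if i = 1 then sqrt ((5 + sqrt 5) / 8) else if i = 4 then - sqrt ((5 + sqrt 5) / 8)
     else if i = 2 then sqrt ((5 - sqrt 5) / 8) else - sqrt ((5 - sqrt 5) / 8))"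

text \<open>The entries are 2/5 cos (2 \<pi> (i - j) / 5) by the addition theorem. The matrix is
  thus circulant, which makes it invariant under the shift.\<close>

lemma plane_cos_sin_nth:
  "plane cos_vec sin_vec $ i $ j =
    (if i = j then 2 / 5 else if j = i + 1 \<or> i = j + 1 then (sqrt 5 - 1) / 10 else - (sqrt 5 + 1) / 10)"
proof -
  define a b where "a = sqrt ((5 + sqrt 5) / 8)" and "b = sqrt ((5 - sqrt 5) / 8)"
  have "sqrt 5 \<le> 5" by (simp add: real_le_lsqrt)
  then have aa: "a * a = (5 + sqrt 5) / 8" and bb: "b * b = (5 - sqrt 5) / 8"
    by (simp_all add: a_def b_def)
  have "(5 + sqrt 5) / 8 * ((5 - sqrt 5) / 8) = (sqrt 5 / 4)\<^sup>2"
    by (simp add: power2_eq_square field_simps)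
  then have ab: "a * b = sqrt 5 / 4"
    unfolding a_def b_def real_sqrt_mult[symmetric] by simp
  define C S where "C i = (if i = 0 then 1 else if i = 1 \<or> i = 4 then (sqrt 5 - 1) / 4
      else - (sqrt 5 + 1) / 4)"
    and "S i = (if i = 0 then 0 else if i = 1 then a else if i = 4 then - a
      else if i = 2 then b else - b)" for i :: 5
  have "cos_vec $ i = sqrt (2 / 5) * C i" "sin_vec $ i = sqrt (2 / 5) * S i" for i
    by (simp_all add: cos_vec_def sin_vec_def C_def S_def a_def b_def)
  then have "plane cos_vec sin_vec $ i $ j =
      (sqrt (2 / 5) * sqrt (2 / 5)) * (C i * C j + S i * S j)" for i j
    unfolding plane_def by (simp only: vec_lambda_beta distrib_left mult_ac)
  then have "plane cos_vec sin_vec $ i $ j = 2 / 5 * (C i * C j + S i * S j)" for i j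
    by simp
  moreover have "\<forall>i j. 2 / 5 * (C i * C j + S i * S j) =
    (if i = j then 2 / 5 else if j = i + 1 \<or> i = j + 1 then (sqrt 5 - 1) / 10 else - (sqrt 5 + 1) / 10)"
    unfolding forall_5 C_def S_def by (simp add: aa bb ab mult.commute[of b a] field_simps)
  ultimately show ?thesis by (simp only:)
qed

lemma orthonormal_cos_sin: "orthonormal cos_vec sin_vec"
proof -
  have "sqrt 5 \<le> 5" by (simp add: real_le_lsqrt)
  then show ?thesis
    by (simp add: orthonormal_def inner_vec_def sum_5 cos_vec_def sin_vec_def field_simps)
qed

lemma shift_action_cos_sin: "shift_action (plane cos_vec sin_vec) = plane cos_vec sin_vec"
  by (simp add: vec_eq_iff shift_action_nth plane_cos_sin_nth)

text \<open>Against a circulant matrix only the diagonal sums of the other projection count; the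
  diagonals d and -d together double the coefficient.\<close>

lemma trace_cos_sin_plane:
  "trace (plane cos_vec sin_vec ** plane p q) =
    2 / 5 * corr p q 0 + (sqrt 5 - 1) / 5 * corr p q 1 - (sqrt 5 + 1) / 5 * corr p q 2"
  by (simp add: trace_def matrix_matrix_mult_def sum_5 plane_cos_sin_nth,
      simp add: plane_def corr_def inner_vec_def sum_5 shift_def numeral_mod_5 field_simps)

section \<open>From lists of coordinates to planes\<close>

definition vec_of :: "real list \<Rightarrow> real^5" where
  "vec_of xs = (\<chi> i. if i = 0 then xs ! 0 else if i = 1 then xs ! 1 else if i = 2 then xs ! 2
     else if i = 3 then xs ! 3 else xs ! 4)"

lemma length_5E:
  assumes "length xs = 5"
  obtains a b c d e where "xs = [a, b, c, d, e]"
  using assms by (auto simp: numeral_eq_Suc length_Suc_conv)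

lemma inner_vec_of:
  "length xs = 5 \<Longrightarrow> length zs = 5 \<Longrightarrow> vec_of xs \<bullet> vec_of zs = sprod xs zs"
  by (elim length_5E) (simp add: vec_of_def inner_vec_def sum_5)

lemma shift_1_vec_of: "length xs = 5 \<Longrightarrow> shift 1 (vec_of xs) = vec_of (rotate1 xs)"
  by (elim length_5E) (simp add: vec_of_def shift_def vec_eq_iff forall_5)

lemma shift_vec_of: "length xs = 5 \<Longrightarrow> shift (of_nat k) (vec_of xs) = vec_of (rotate k xs)"
proof (induction k)
  case (Suc k)
  then show ?case
    using shift_shift[of 1 "of_nat k" "vec_of xs"] by (simp add: shift_1_vec_of)
qed (simp add: shift_0)

lemma exists_planes:
  "\<exists>p q r s. orthonormal p q \<and> orthonormal r s \<and>
    corr p q 1 = diag_sum1 1 \<and> corr p q 2 = diag_sum2 1 \<and>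
    corr r s 1 = diag_sum1 (-1) \<and> corr r s 2 = diag_sum2 (-1) \<and>
    overlap p q p q 1 = 17 / 25 \<and> overlap r s r s 1 = 17 / 25 \<and>
    (\<forall>k\<in>{0, 1, 2, 3}. overlap p q r s k = 17 / 25)"
proof -
  obtain y where y: "\<forall>x\<in>set (residuals y). x = 0" using residuals_zero ..
  define u where "u as = map (\<lambda>a. center a y) as" for as
  have len: "length (u form_p) = 5" "length (u form_q) = 5" "length (u form_r) = 5" "length (u form_s) = 5"
    by (simp_all add: u_def form_p_def form_q_def form_r_def form_s_def)
  \<comment> \<open>This undoes the scaling of the bases, so inner products are divided by
    \<open>10 ^ 10\<close> and traces by \<open>10 ^ 20\<close>.\<close>
  define w where "w xs = (1 / 10 ^ 5) *\<^sub>R vec_of xs" for xs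
  have inner: "w xs \<bullet> shift (of_nat k) (w zs) = sprod xs (rotate k zs) / 10 ^ 10"
    if "length xs = 5" "length zs = 5" for xs zs k
    using that by (simp add: w_def shift_scaleR shift_vec_of inner_vec_of)
  have inner0: "w xs \<bullet> w zs = sprod xs zs / 10 ^ 10" if "length xs = 5" "length zs = 5" for xs zs
    using inner[OF that, of 0] by (simp add: shift_0)
  have overlap: "overlap (w xs) (w xs') (w zs) (w zs') (of_nat k) =
      quad xs xs' (rotate k zs) (rotate k zs') / 10 ^ 20"
    if "length xs = 5" "length xs' = 5" "length zs = 5" "length zs' = 5" for xs xs' zs zs' k
    using that by (simp add: overlap_def quad_def inner power2_eq_square field_simps)
  have corr: "corr (w xs) (w xs') (of_nat k) =
      (sprod xs (rotate k xs) + sprod xs' (rotate k xs')) / 10 ^ 10"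
    if "length xs = 5" "length xs' = 5" for xs xs' k
    using that by (simp add: corr_def inner field_simps)
  define p q r s where "p = u form_p" and "q = u form_q" and "r = u form_r" and "s = u form_s"
  note len = len[folded p_def q_def r_def s_def]
  have "\<forall>x\<in>set (pair_residuals p q (diag_sum1 1) (diag_sum2 1)). x = 0"
    "\<forall>x\<in>set (pair_residuals r s (diag_sum1 (-1)) (diag_sum2 (-1))). x = 0"
    "\<forall>x\<in>set (cross_residuals p q r s). x = 0"
    using y unfolding residuals_def Let_def set_append p_def q_def r_def s_def u_def by blast+
  note zero = this[unfolded pair_residuals_def cross_residuals_def]
  have "orthonormal (w p) (w q)" "orthonormal (w r) (w s)"
    using zero by (simp_all add: orthonormal_def inner0 len)
  moreover have "corr (w p) (w q) (of_nat 1) = diag_sum1 1" "corr (w r) (w s) (of_nat 1) = diag_sum1 (-1)"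
      "corr (w p) (w q) (of_nat 2) = diag_sum2 1" "corr (w r) (w s) (of_nat 2) = diag_sum2 (-1)"
    unfolding corr[OF len(1,2)] corr[OF len(3,4)] using zero by simp_all
  moreover have "overlap (w p) (w q) (w p) (w q) (of_nat 1) = 17 / 25"
      "overlap (w r) (w s) (w r) (w s) (of_nat 1) = 17 / 25"
    unfolding overlap[OF len(1,2,1,2)] overlap[OF len(3,4,3,4)] using zero by simp_all
  moreover have "overlap (w p) (w q) (w r) (w s) (of_nat k) = 17 / 25" if "k \<in> {0, 1, 2, 3}" for k
    unfolding overlap[OF len] using zero(3) that by auto
  note this[of 0] this[of 1] this[of 2] this[of 3]
  ultimately show ?thesis
    by (intro exI[of _ "w p"] exI[of _ "w q"] exI[of _ "w r"] exI[of _ "w s"]) simp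
qed

text \<open>These are the conditions on the diagonal sums in \<open>overlap_orbit\<close>, for each
  of the two planes, and in \<open>overlap_cross\<close>.\<close>

lemma diag_sum_products:
  "(diag_sum1 1)\<^sup>2 + (diag_sum2 1)\<^sup>2 = 9 / 25"
  "(diag_sum1 (-1))\<^sup>2 + (diag_sum2 (-1))\<^sup>2 = 9 / 25"
  "diag_sum1 1 * diag_sum1 (-1) + diag_sum2 1 * diag_sum2 (-1) = - 3 / 10"
proof -
  define a b where "a = sqrt 5" and "b = sqrt 11"
  have ab: "a * a = 5" "b * b = 11" "a * (a * x) = 5 * x" "b * (b * x) = 11 * x" for x
    by (simp_all add: a_def b_def flip: mult.assoc)
  show
  "(diag_sum1 1)\<^sup>2 + (diag_sum2 1)\<^sup>2 = 9 / 25"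
  "(diag_sum1 (-1))\<^sup>2 + (diag_sum2 (-1))\<^sup>2 = 9 / 25"
  "diag_sum1 1 * diag_sum1 (-1) + diag_sum2 1 * diag_sum2 (-1) = - 3 / 10"
    unfolding diag_sum1_def diag_sum2_def a_def[symmetric] b_def[symmetric] power2_eq_square
    by (simp_all add: field_simps ab)
qed

text \<open>The terms with \<open>t\<close> cancel, since each carries the factor (sqrt 5 - 1)(sqrt
  5 + 1). Hence both planes have the right trace with the invariant plane.\<close>

lemma diag_sum_trace:
  "4 / 5 + (sqrt 5 - 1) / 5 * diag_sum1 t - (sqrt 5 + 1) / 5 * diag_sum2 t = 17 / 25"
proof -
  define a b where "a = sqrt 5" and "b = sqrt 11"
  have ab: "a * a = 5" "a * (a * x) = 5 * x" for x
    by (simp_all add: a_def flip: mult.assoc)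
  show ?thesis
    unfolding diag_sum1_def diag_sum2_def a_def[symmetric] b_def[symmetric]
    by (simp add: field_simps ab)
qed

theorem theorem6p6:
  shows "\<exists>S :: (real^5^5) set. tight_simplex 2 11 S \<and> shift_action ` S = S"
proof -
  obtain p q r s where orth: "orthonormal p q" "orthonormal r s"
    and corr: "corr p q 1 = diag_sum1 1" "corr p q 2 = diag_sum2 1"
      "corr r s 1 = diag_sum1 (-1)" "corr r s 2 = diag_sum2 (-1)"
    and over: "overlap p q p q 1 = 17 / 25" "overlap r s r s 1 = 17 / 25"
      "\<And>k. k \<in> {0, 1, 2, 3} \<Longrightarrow> overlap p q r s k = 17 / 25"
    using exists_planes by blast
  \<comment> \<open>The index type has 1 + 5 + 5 elements: \<open>None\<close> for the invariant
    plane and one summand for each orbit.\<close>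
  define u :: "(5 + 5) option \<Rightarrow> real^5" where
    "u i = (case i of None \<Rightarrow> cos_vec | Some (Inl k) \<Rightarrow> shift k p | Some (Inr k) \<Rightarrow> shift k r)" for i
  define v :: "(5 + 5) option \<Rightarrow> real^5" where
    "v i = (case i of None \<Rightarrow> sin_vec | Some (Inl k) \<Rightarrow> shift k q | Some (Inr k) \<Rightarrow> shift k s)" for i
  have card: "CARD((5 + 5) option) = 11" by simp
  have shifted: "orthonormal (shift k a) (shift k b)" if "orthonormal a b" for k a b
    using that by (simp add: orthonormal_def inner_shift_shift shift_0)
  have pq: "overlap p q p q k = 17 / 25" if "k \<noteq> 0" for k
    by (rule overlap_orbit[OF orth(1) _ over(1) that]) (simp only: corr diag_sum_products)
  have rs: "overlap r s r s k = 17 / 25" if "k \<noteq> 0" for k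
    by (rule overlap_orbit[OF orth(2) _ over(2) that]) (simp only: corr diag_sum_products)
  have pqrs: "overlap p q r s k = 17 / 25" for k
    by (rule overlap_cross[OF orth _ over(3)]) (simp_all only: corr diag_sum_products)
  have rspq: "overlap r s p q k = 17 / 25" for k
    using pqrs[of "- k"] by (simp only: overlap_minus)
  have fixed: "trace (plane cos_vec sin_vec ** plane (shift k p) (shift k q)) = 17 / 25"
      "trace (plane cos_vec sin_vec ** plane (shift k r) (shift k s)) = 17 / 25" for k
    using diag_sum_trace[of 1] diag_sum_trace[of "-1"]
    by (simp_all add: trace_cos_sin_plane corr_shift corr corr_0 orth)
  then have fixed': "trace (plane (shift k p) (shift k q) ** plane cos_vec sin_vec) = 17 / 25"
      "trace (plane (shift k r) (shift k s) ** plane cos_vec sin_vec) = 17 / 25" for k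
    by (simp_all only: trace_mul_sym[of "plane (shift k _) _"])
  \<comment> \<open>The value 17/25 is 2 (11 * 2 - 5) / (5 * 10), the trace required of a tight
    simplex.\<close>
  have tr: "trace (plane (u i) (v i) ** plane (u j) (v j)) = 17 / 25" if "i \<noteq> j" for i j
    using that unfolding u_def v_def
    by (cases i; cases j; cases "the i"; cases "the j")
      (simp_all add: fixed fixed' trace_shifted_planes pq rs pqrs rspq)
  define S where "S = range (\<lambda>i. plane (u i) (v i))"
  have "tight_simplex 2 CARD((5 + 5) option) S"
    unfolding S_def
  proof (rule tight_simplex_range)
    show "orthonormal (u i) (v i)" for i
      by (auto simp: u_def v_def orthonormal_cos_sin shifted orth split: option.splits sum.splits)
    show "trace (plane (u i) (v i) ** plane (u j) (v j)) =
        2 * (real CARD((5 + 5) option) * 2 - real CARD(5)) /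
        (real CARD(5) * (real CARD((5 + 5) option) - 1))" if "i \<noteq> j" for i j
      unfolding tr[OF that] card by simp
    show "2 * (real CARD((5 + 5) option) * 2 - real CARD(5)) /
        (real CARD(5) * (real CARD((5 + 5) option) - 1)) \<noteq> 2"
      unfolding card by simp
  qed
  moreover have "shift_action ` S = S"
  proof -
    \<comment> \<open>The shift permutes the indices: it fixes \<open>None\<close> and rotates each
      orbit by one step.\<close>
    define g :: "(5 + 5) option \<Rightarrow> (5 + 5) option" where
      "g = map_option (map_sum ((+) 1) ((+) 1))"
    have act: "shift_action (plane (u i) (v i)) = plane (u (g i)) (v (g i))" for i
    proof (cases i)
      case None
      then show ?thesis by (simp add: u_def v_def g_def shift_action_cos_sin)
    next
      case (Some x)
      then show ?thesis
        by (cases x) (simp_all add: u_def v_def g_def shift_action_plane shift_shift)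
    qed
    have "surj g"
    proof (rule surjI)
      have inverse: "1 + (k - 1) = k" for k :: 5 by (metis add.commute diff_add_cancel)
      show "g (map_option (map_sum (\<lambda>k. k - 1) (\<lambda>k. k - 1)) i) = i" for i
      proof (cases i)
        case (Some x)
        then show ?thesis by (cases x) (simp_all only: g_def inverse map_sum.simps option.map)
      qed (simp add: g_def)
    qed
    then have "range (\<lambda>i. plane (u (g i)) (v (g i))) = S"
      unfolding S_def using image_image[of "\<lambda>i. plane (u i) (v i)" g UNIV] by simp
    then show ?thesis by (simp only: S_def image_image act)
  qed
  ultimately show ?thesis
    unfolding card by (intro exI conjI)
qed

end
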